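(* For each graph $G$ with $E(G)\neq\emptyset$ the following are equivalent. (i) For each metrizable weight $w:E(G)\to[0,\infty)$ the set $\mathfrak M_w$ contains a least pseudometric $\rho_{0,w}$, and $\mathfrak M_w$ contains every symmetric function $f:V(G)\times V(G)\to[0,\infty)$ satisfying $\rho_{0,w}(u,v)\le f(u,v)\le d_w(u,v)$ for all $u,v\in V(G)$. (ii) $G$ is a complete $k$-partite graph with a partition $\{X_\alpha:\alpha\in\mathcal I\}$ such that $\operatorname{card}\mathcal I=k\geqslant2$ and $\operatorname{card}X_\alpha\le2$ for each $\alpha\in\mathcal I$.
   Context: Graphs are simple, possibly infinite; paths are finite. For a subgraph $F$, $w(F)=\sum_{e\in E(F)}w(e)$. A weight $w$ is metrizable if there is a pseudometric $d$ on $V(G)$ with $d(u,v)=w(\{u,v\})$ for all edges $\{u,v\}$. $\mathfrak M_w$ is the set of all pseudometrics $\rho$ on $V(G)$ with $\rho(u,v)=w(\{u,v\})$ for all $\{u,v\}\in E(G)$; "least" refers to the order $\rho_1\leqslant\rho_2$ iff $\rho_1(u,v)\le\rho_2(u,v)$ for all $u,v$. $d_w(u,v)=\inf\{w(F):F\text{ a path joining }u,v\}$, with $d_w(u,v)=+\infty$ if no such path exists. For a cardinal $k$, $G$ is complete $k$-partite with partition $\{X_\alpha\}$ if the $X_\alpha$ are $k$ nonempty disjoint sets covering $V(G)$, no edge has both ends in one part, and any two vertices in different parts are adjacent. *)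

theory Defs
  imports "HOL-Library.Extended_Real" "HOL-Library.Disjoint_Sets"
begin

text \<open>A simple graph, possibly infinite, is given by a vertex set \<open>V\<close> and a set \<open>E\<close> of
  two-element subsets of \<open>V\<close>. Functions on \<open>V \<times> V\<close> and on \<open>E\<close> are total HOL functions
  about which nothing is assumed, and nothing is claimed, outside \<open>V\<close> and \<open>E\<close>.\<close>

definition simple_graph :: "'a set \<Rightarrow> 'a set set \<Rightarrow> bool" where
  "simple_graph V E \<longleftrightarrow> (\<forall>e\<in>E. e \<subseteq> V \<and> card e = 2)"

definition graph_weight :: "'a set set \<Rightarrow> ('a set \<Rightarrow> real) \<Rightarrow> bool" where
  "graph_weight E w \<longleftrightarrow> (\<forall>e\<in>E. 0 \<le> w e)"

definition pseudometric_on :: "'a set \<Rightarrow> ('a \<Rightarrow> 'a \<Rightarrow> real) \<Rightarrow> bool" where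
  "pseudometric_on V d \<longleftrightarrow>
     (\<forall>u\<in>V. \<forall>v\<in>V. 0 \<le> d u v) \<and>
     (\<forall>u\<in>V. d u u = 0) \<and>
     (\<forall>u\<in>V. \<forall>v\<in>V. d u v = d v u) \<and>
     (\<forall>u\<in>V. \<forall>v\<in>V. \<forall>x\<in>V. d u v \<le> d u x + d x v)"

definition metrizations ::
  "'a set \<Rightarrow> 'a set set \<Rightarrow> ('a set \<Rightarrow> real) \<Rightarrow> ('a \<Rightarrow> 'a \<Rightarrow> real) set" where
  "metrizations V E w =
     {\<rho>. pseudometric_on V \<rho> \<and> (\<forall>u\<in>V. \<forall>v\<in>V. {u, v} \<in> E \<longrightarrow> \<rho> u v = w {u, v})}"

definition metrizable_weight :: "'a set \<Rightarrow> 'a set set \<Rightarrow> ('a set \<Rightarrow> real) \<Rightarrow> bool" where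
  "metrizable_weight V E w \<longleftrightarrow> graph_weight E w \<and> metrizations V E w \<noteq> {}"

definition least_metrization ::
  "'a set \<Rightarrow> 'a set set \<Rightarrow> ('a set \<Rightarrow> real) \<Rightarrow> ('a \<Rightarrow> 'a \<Rightarrow> real) \<Rightarrow> bool" where
  "least_metrization V E w \<rho>\<^sub>0 \<longleftrightarrow>
     \<rho>\<^sub>0 \<in> metrizations V E w \<and>
     (\<forall>\<rho>\<in>metrizations V E w. \<forall>u\<in>V. \<forall>v\<in>V. \<rho>\<^sub>0 u v \<le> \<rho> u v)"

text \<open>A path is given by the list of its vertices in order. The one-vertex path joins \<open>u\<close> to
  \<open>u\<close>.\<close>

definition path_joining :: "'a set \<Rightarrow> 'a set set \<Rightarrow> 'a \<Rightarrow> 'a \<Rightarrow> 'a list \<Rightarrow> bool" where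
  "path_joining V E u v p \<longleftrightarrow>
     p \<noteq> [] \<and> set p \<subseteq> V \<and> distinct p \<and> successively (\<lambda>x y. {x, y} \<in> E) p \<and>
     hd p = u \<and> last p = v"

definition path_edges :: "'a list \<Rightarrow> 'a set set" where
  "path_edges p = {{p ! i, p ! Suc i} | i. Suc i < length p}"

text \<open>The infimum over the empty set of paths is \<open>\<infinity>\<close>.\<close>

definition path_dist :: "'a set \<Rightarrow> 'a set set \<Rightarrow> ('a set \<Rightarrow> real) \<Rightarrow> 'a \<Rightarrow> 'a \<Rightarrow> ereal" where
  "path_dist V E w u v = (INF p\<in>{p. path_joining V E u v p}. ereal (\<Sum>e\<in>path_edges p. w e))"

text \<open>Parts are nonempty and pairwise disjoint, so a family of parts is the same as
  the set \<open>P\<close> of its members, and the number \<open>k\<close> of parts is the cardinality of \<open>P\<close>.\<close>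

definition complete_partite :: "'a set \<Rightarrow> 'a set set \<Rightarrow> 'a set set \<Rightarrow> bool" where
  "complete_partite V E P \<longleftrightarrow>
     partition_on V P \<and>
     (\<forall>A\<in>P. \<forall>u\<in>A. \<forall>v\<in>A. {u, v} \<notin> E) \<and>
     (\<forall>A\<in>P. \<forall>B\<in>P. A \<noteq> B \<longrightarrow> (\<forall>u\<in>A. \<forall>v\<in>B. {u, v} \<in> E))"

end

theory Submission
  imports Defs
begin

text \<open>Condition (ii) says that every vertex has at most one non-neighbour other than itself,
  and this is what both implications use.

  If \<open>a \<noteq> c\<close> are both non-adjacent to \<open>b\<close>, take \<open>w = 1\<close>. Identifying two non-adjacent vertices in
  the discrete metric shows that the least metrization vanishes on all non-edges; this is
  impossible if \<open>{a, c}\<close> is an edge, and otherwise raising the value at \<open>{a, b}\<close> to \<open>1\<close>, which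
  is still at most the path distance, violates the triangle inequality through \<open>c\<close>.

  Conversely, if the condition holds, a non-adjacent pair \<open>u, v\<close> is adjacent to every other
  vertex \<open>x\<close>, so the only constraints on \<open>f u v\<close> are
  \<open>\<bar>w {u, x} - w {v, x}\<bar> \<le> f u v \<le> w {u, x} + w {x, v}\<close>. The supremum of the lower bounds is the
  least metrization, and the path distance is at most each upper bound.\<close>

section \<open>Complete multipartite graphs with parts of size at most two\<close>

text \<open>In other words, the edges of the complement graph form a matching. Recording
  \<open>{u, x}\<close> alone suffices, because exchanging \<open>u\<close> and \<open>v\<close>
  yields \<open>{v, x}\<close>.\<close>

definition complement_matching :: "'a set \<Rightarrow> 'a set set \<Rightarrow> bool" where
  "complement_matching V E \<longleftrightarrow>
     (\<forall>u\<in>V. \<forall>v\<in>V. \<forall>x\<in>V. u \<noteq> v \<and> x \<noteq> u \<and> x \<noteq> v \<and> {u, v} \<notin> E \<longrightarrow> {u, x} \<in> E)"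

lemma complement_matchingD:
  assumes "complement_matching V E" "u \<in> V" "v \<in> V" "x \<in> V"
    and "u \<noteq> v" "x \<noteq> u" "x \<noteq> v" "{u, v} \<notin> E"
  shows "{u, x} \<in> E" "{v, x} \<in> E"
  using assms unfolding complement_matching_def by (blast, metis insert_commute)

lemma simple_graph_no_loop: "simple_graph V E \<Longrightarrow> {u, u} \<notin> E"
  unfolding simple_graph_def by fastforce

lemma simple_graph_edgeE:
  assumes "simple_graph V E" "e \<in> E"
  obtains p q where "p \<in> V" "q \<in> V" "p \<noteq> q" "e = {p, q}"
  using assms unfolding simple_graph_def by (metis card_2_iff insert_subset)

text \<open>Different parts are fully joined, so a non-adjacent pair fills one part, and every third
  vertex lies in another part.\<close>

lemma complete_partite_imp_complement_matching:
  assumes P: "complete_partite V E P" and small: "\<forall>A\<in>P. finite A \<and> card A \<le> 2"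
  shows "complement_matching V E"
  unfolding complement_matching_def
proof (intro ballI impI, elim conjE)
  fix u v x assume V: "u \<in> V" "v \<in> V" "x \<in> V"
    and ne: "u \<noteq> v" "x \<noteq> u" "x \<noteq> v" and nE: "{u, v} \<notin> E"
  have cover: "\<And>y. y \<in> V \<Longrightarrow> \<exists>A\<in>P. y \<in> A"
    using P unfolding complete_partite_def partition_on_def by blast
  obtain A B C where ABC: "A \<in> P" "u \<in> A" "B \<in> P" "v \<in> B" "C \<in> P" "x \<in> C"
    using cover V by meson
  have adj: "\<And>A B u v. A \<in> P \<Longrightarrow> B \<in> P \<Longrightarrow> A \<noteq> B \<Longrightarrow> u \<in> A \<Longrightarrow> v \<in> B \<Longrightarrow> {u, v} \<in> E"
    using P by (simp add: complete_partite_def)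
  have "v \<in> A" using adj ABC nE by metis
  have "x \<notin> A"
  proof
    assume "x \<in> A"
    then have "{u, v, x} \<subseteq> A" using ABC \<open>v \<in> A\<close> by blast
    then have "card {u, v, x} \<le> card A" using small ABC by (meson card_mono)
    then have "card {u, v, x} \<le> 2" using small ABC by fastforce
    then show False using ne by simp
  qed
  then show "{u, x} \<in> E" using adj ABC by metis
qed

text \<open>The parts are the sets \<open>N u\<close> of vertices not adjacent to \<open>u\<close>,
  with \<open>u\<close> itself included. Since \<open>N u\<close> has at most one further element,
  non-adjacency is an equivalence relation.\<close>

lemma complement_matching_imp_complete_partite:
  assumes G: "simple_graph V E" and "E \<noteq> {}" and M: "complement_matching V E"
  shows "\<exists>P. complete_partite V E P \<and> (finite P \<longrightarrow> 2 \<le> card P) \<and>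
           (\<forall>A\<in>P. finite A \<and> card A \<le> 2)"
proof -
  define N where "N u = {v\<in>V. {u, v} \<notin> E}" for u
  have self: "u \<in> N u" if "u \<in> V" for u
    using that simple_graph_no_loop[OF G] by (simp add: N_def)
  have sym: "v \<in> N u \<longleftrightarrow> u \<in> N v" if "u \<in> V" "v \<in> V" for u v
    using that by (simp add: N_def insert_commute)
  have two: "x = u \<or> x = v" if "u \<in> V" "v \<in> N u" "u \<noteq> v" "x \<in> N u" for u v x
    using complement_matchingD(1)[OF M, of u v x] that by (auto simp: N_def)
  have N_eq: "N u = N v" if "u \<in> V" "v \<in> N u" for u v
  proof (cases "u = v")
    case False
    have "v \<in> V" using that by (simp add: N_def)
    have "N u = {u, v}" using two[OF that False] self that by blast
    moreover have "N v = {v, u}" using two[of v u] self sym that False \<open>v \<in> V\<close> by blast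
    ultimately show ?thesis by blast
  qed simp
  have "partition_on V (N ` V)"
  proof (rule partition_onI)
    show "\<And>p q. p \<in> N ` V \<Longrightarrow> q \<in> N ` V \<Longrightarrow> p \<noteq> q \<Longrightarrow> disjnt p q"
      unfolding disjnt_iff using N_eq by (metis imageE)
    show "\<Union> (N ` V) = V" using self by (auto simp: N_def)
    show "{} \<notin> N ` V" using self by blast
  qed
  moreover have "{u, v} \<notin> E" if "A \<in> N ` V" "u \<in> A" "v \<in> A" for A u v
  proof -
    have "v \<in> N u" using N_eq that by (metis imageE)
    then show ?thesis by (simp add: N_def)
  qed
  moreover have "{u, v} \<in> E" if "A \<in> N ` V" "B \<in> N ` V" "A \<noteq> B" "u \<in> A" "v \<in> B" for A B u v
  proof (rule ccontr)
    assume "{u, v} \<notin> E"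
    moreover have "u \<in> V" "v \<in> V" using that by (auto simp: N_def)
    ultimately have "N u = N v" using N_eq by (simp add: N_def)
    then show False using N_eq that by (metis imageE)
  qed
  ultimately have "complete_partite V E (N ` V)"
    unfolding complete_partite_def by (intro conjI ballI impI)
  \<comment> \<open>\<open>card\<close> is 0 on infinite sets, hence the guard: an infinite family
    has cardinality at least 2 anyway. The ends of an edge lie in different classes.\<close>
  moreover have "finite (N ` V) \<longrightarrow> 2 \<le> card (N ` V)"
  proof
    assume fin: "finite (N ` V)"
    obtain p q where pq: "p \<in> V" "q \<in> V" "{p, q} \<in> E"
      using simple_graph_edgeE[OF G] \<open>E \<noteq> {}\<close> by (metis ex_in_conv)
    then have "q \<notin> N p" by (simp add: N_def)
    then have "N p \<noteq> N q" using self pq by blast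
    then have "card {N p, N q} = 2" by simp
    then show "2 \<le> card (N ` V)"
      using pq fin by (metis card_mono empty_subsetI image_eqI insert_subset)
  qed
  moreover have "finite (N u) \<and> card (N u) \<le> 2" if "u \<in> V" for u
  proof -
    have "\<exists>v. N u \<subseteq> {u, v}" using two that by blast
    then obtain v where "N u \<subseteq> {u, v}" ..
    moreover have "card {u, v} \<le> 2" by (simp add: card_insert_if)
    ultimately show ?thesis by (meson card_mono finite.emptyI finite.insertI finite_subset le_trans)
  qed
  ultimately show ?thesis by (intro exI[of _ "N ` V"]) blast
qed

section \<open>Bounds on the path distance from short paths\<close>

lemma path_dist_le:
  "path_joining V E u v p \<Longrightarrow> path_dist V E w u v \<le> ereal (\<Sum>e\<in>path_edges p. w e)"
  unfolding path_dist_def by (rule INF_lower) simp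

lemma path_edges_eq_image:
  "path_edges p = (\<lambda>i. {p ! i, p ! Suc i}) ` {i. Suc i < length p}"
  unfolding path_edges_def by blast

lemma path_edges_simps [simp]:
  "path_edges [x] = {}"
  "path_edges (x # y # p) = insert {x, y} (path_edges (y # p))"
proof -
  show "path_edges [x] = {}" by (simp add: path_edges_def)
  \<comment> \<open>Index 0 gives the first edge, and the shifted indices give the edges of the
    tail.\<close>
  have "{i. Suc i < length (x # y # p)} = insert 0 (Suc ` {i. Suc i < length (y # p)})"
    by (auto simp: image_iff gr0_conv_Suc less_Suc_eq_0_disj)
  then show "path_edges (x # y # p) = insert {x, y} (path_edges (y # p))"
    unfolding path_edges_eq_image by (simp add: image_image)
qed

lemma finite_path_edges: "finite (path_edges p)"
proof -
  have "finite {i. Suc i < length p}" by (rule finite_subset[of _ "{..<length p}"]) auto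
  then show ?thesis by (simp add: path_edges_eq_image)
qed

lemma path_dist_self_le: "u \<in> V \<Longrightarrow> path_dist V E w u u \<le> 0"
  using path_dist_le[of V E u u "[u]" w] by (simp add: path_joining_def zero_ereal_def)

lemma path_dist_edge_le:
  "u \<in> V \<Longrightarrow> v \<in> V \<Longrightarrow> u \<noteq> v \<Longrightarrow> {u, v} \<in> E \<Longrightarrow> path_dist V E w u v \<le> ereal (w {u, v})"
  using path_dist_le[of V E u v "[u, v]" w] by (simp add: path_joining_def)

lemma path_dist_two_edges_le:
  assumes "u \<in> V" "x \<in> V" "v \<in> V" "u \<noteq> v" "x \<noteq> u" "x \<noteq> v" "{u, x} \<in> E" "{x, v} \<in> E"
  shows "path_dist V E w u v \<le> ereal (w {u, x} + w {x, v})"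
proof -
  \<comment> \<open>\<open>path_edges\<close> is a set, so both weights are counted only if the two
    edges differ.\<close>
  have "{u, x} \<noteq> {x, v}" using assms by (auto simp: doubleton_eq_iff)
  then show ?thesis
    using path_dist_le[of V E u v "[u, x, v]" w] assms by (auto simp: path_joining_def)
qed

text \<open>With weight 1 the sum counts edges, and a path between distinct vertices has at least
  one. Without any path the infimum is infinite and the bound still holds.\<close>

lemma path_dist_one_ge:
  assumes "u \<noteq> v"
  shows "1 \<le> path_dist V E (\<lambda>_. 1) u v"
  unfolding path_dist_def
proof (rule INF_greatest)
  fix p assume "p \<in> {p. path_joining V E u v p}"
  then have p: "p \<noteq> []" "hd p = u" "last p = v" by (auto simp: path_joining_def)
  then obtain y q where "p = u # y # q"
    using assms by (metis last_ConsL list.collapse)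
  then have "path_edges p \<noteq> {}" by simp
  then have "1 \<le> card (path_edges p)"
    by (metis One_nat_def Suc_leI card_gt_0_iff finite_path_edges)
  then show "1 \<le> ereal (\<Sum>e\<in>path_edges p. 1)" by (simp add: one_ereal_def)
qed

section \<open>The least pseudometric and the functions above it\<close>

text \<open>Among three distinct vertices at most one pair is non-adjacent, so each triangle
  inequality has at most one value not fixed by \<open>w\<close>. It serves both the least
  pseudometric and every \<open>f\<close> between it and the path distance.\<close>

lemma metrization_of_nonedge_bounds:
  assumes M: "complement_matching V E"
    and \<rho>: "\<rho> \<in> metrizations V E w"
    and nonneg: "\<And>u v. u \<in> V \<Longrightarrow> v \<in> V \<Longrightarrow> 0 \<le> f u v"
    and sym: "\<And>u v. u \<in> V \<Longrightarrow> v \<in> V \<Longrightarrow> f u v = f v u"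
    and self: "\<And>u. u \<in> V \<Longrightarrow> f u u = 0"
    and edge: "\<And>u v. u \<in> V \<Longrightarrow> v \<in> V \<Longrightarrow> {u, v} \<in> E \<Longrightarrow> f u v = w {u, v}"
    and lower: "\<And>u v x. u \<in> V \<Longrightarrow> v \<in> V \<Longrightarrow> x \<in> V \<Longrightarrow> u \<noteq> v \<Longrightarrow> x \<noteq> u \<Longrightarrow> x \<noteq> v \<Longrightarrow>
      {u, v} \<notin> E \<Longrightarrow> \<bar>w {u, x} - w {v, x}\<bar> \<le> f u v"
    and upper: "\<And>u v x. u \<in> V \<Longrightarrow> v \<in> V \<Longrightarrow> x \<in> V \<Longrightarrow> u \<noteq> v \<Longrightarrow> x \<noteq> u \<Longrightarrow> x \<noteq> v \<Longrightarrow>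
      {u, v} \<notin> E \<Longrightarrow> f u v \<le> w {u, x} + w {v, x}"
  shows "f \<in> metrizations V E w"
proof -
  have "f u v \<le> f u x + f x v" if V: "u \<in> V" "v \<in> V" "x \<in> V" for u v x
  proof (cases "u = v \<or> x = u \<or> x = v")
    case True
    then show ?thesis using nonneg sym self V by fastforce
  next
    case False
    then have ne: "u \<noteq> v" "x \<noteq> u" "x \<noteq> v" by auto
    consider "{u, v} \<notin> E" | "{u, v} \<in> E" "{u, x} \<notin> E" | "{u, v} \<in> E" "{v, x} \<notin> E"
      | "{u, v} \<in> E" "{u, x} \<in> E" "{v, x} \<in> E" by blast
    then show ?thesis
    proof cases
      case 1
      then have "{u, x} \<in> E" "{v, x} \<in> E" using complement_matchingD[OF M] V ne by metis+
      then show ?thesis using upper[of u v x] edge[of u x] edge[of v x] sym[of v x] 1 V ne by simp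
    next
      \<comment> \<open>The missing pair is on the right-hand side, so the lower bound for
        \<open>f u x\<close> with third vertex \<open>v\<close> applies; case 3 is its mirror
        image.\<close>
      case 2
      then have "{x, v} \<in> E" using complement_matchingD[OF M, of u x v] V ne by metis
      then show ?thesis
        using lower[of u x v] edge[of u v] edge[of x v] 2 V ne by auto
    next
      case 3
      then have "{x, u} \<in> E" using complement_matchingD[OF M, of v x u] V ne by metis
      then show ?thesis
        using lower[of v x u] edge[of v u] edge[of x u] sym[of u v] sym[of u x] sym[of v x] 3 V ne
        by (auto simp: insert_commute)
    next
      \<comment> \<open>All three values are weights, and the inequality between them is inherited
        from \<open>\<rho>\<close>.\<close>
      case 4
      have "\<rho> u v \<le> \<rho> u x + \<rho> x v" "\<rho> x v = \<rho> v x"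
        using \<rho> V by (auto simp: metrizations_def pseudometric_on_def)
      moreover have "\<rho> u v = w {u, v}" "\<rho> u x = w {u, x}" "\<rho> v x = w {v, x}"
        using \<rho> V 4 by (auto simp: metrizations_def)
      ultimately show ?thesis
        using edge[of u v] edge[of u x] edge[of v x] sym[of v x] 4 V by simp
    qed
  qed
  then show ?thesis
    using nonneg self edge sym unfolding metrizations_def pseudometric_on_def by blast
qed

lemma complement_matching_imp_least_metrization:
  assumes G: "simple_graph V E" and "E \<noteq> {}" and M: "complement_matching V E"
    and w: "metrizable_weight V E w"
  shows "\<exists>\<rho>\<^sub>0. least_metrization V E w \<rho>\<^sub>0 \<and>
          (\<forall>f :: 'a \<Rightarrow> 'a \<Rightarrow> real.
             (\<forall>u\<in>V. \<forall>v\<in>V. 0 \<le> f u v \<and> f u v = f v u) \<and>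
             (\<forall>u\<in>V. \<forall>v\<in>V. \<rho>\<^sub>0 u v \<le> f u v \<and> ereal (f u v) \<le> path_dist V E w u v)
             \<longrightarrow> f \<in> metrizations V E w)"
proof -
  obtain \<rho> where \<rho>: "\<rho> \<in> metrizations V E w"
    using w by (auto simp: metrizable_weight_def)
  have w_nonneg: "0 \<le> w e" if "e \<in> E" for e
    using w that by (auto simp: metrizable_weight_def graph_weight_def)
  define S where "S u v = (SUP x\<in>V - {u, v}. \<bar>w {u, x} - w {v, x}\<bar>)" for u v
  define r where "r u v = (if u = v then 0 else if {u, v} \<in> E then w {u, v} else S u v)" for u v
  \<comment> \<open>A real supremum over the empty set would be unspecified. With no third vertex,
    the existing edge would have to be \<open>{u, v}\<close>.\<close>
  have third: "V - {u, v} \<noteq> {}" if "u \<in> V" "v \<in> V" "{u, v} \<notin> E" for u v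
  proof
    assume empty: "V - {u, v} = {}"
    obtain p q where "p \<in> V" "q \<in> V" "p \<noteq> q" "{p, q} \<in> E"
      using simple_graph_edgeE[OF G] \<open>E \<noteq> {}\<close> by (metis ex_in_conv)
    with empty have "{p, q} = {u, v}" by blast
    with \<open>{p, q} \<in> E\<close> that show False by simp
  qed
  \<comment> \<open>This is the reverse triangle inequality. For arbitrary \<open>d\<close> it makes
    \<open>S\<close> a lower bound of all metrizations; for \<open>d = \<rho>\<close> it shows that
    the supremum is over a bounded set.\<close>
  have diff_le: "\<bar>w {u, x} - w {v, x}\<bar> \<le> d u v"
    if d: "d \<in> metrizations V E w" and V: "u \<in> V" "v \<in> V" "u \<noteq> v" "{u, v} \<notin> E" "x \<in> V - {u, v}"
    for d u v x
  proof -
    have "{u, x} \<in> E" "{v, x} \<in> E" using complement_matchingD[OF M, of u v x] V by auto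
    then have "d u x = w {u, x}" "d v x = w {v, x}"
      using d V by (auto simp: metrizations_def)
    moreover have "d p q \<le> d p t + d t q" if "p \<in> V" "q \<in> V" "t \<in> V" for p q t
      using d that unfolding metrizations_def pseudometric_on_def by blast
    then have "d u x \<le> d u v + d v x" "d v x \<le> d v u + d u x" using V by auto
    moreover have "d v u = d u v"
      using d V by (simp add: metrizations_def pseudometric_on_def)
    ultimately show ?thesis by linarith
  qed
  have S_le: "S u v \<le> d u v"
    if "d \<in> metrizations V E w" "u \<in> V" "v \<in> V" "u \<noteq> v" "{u, v} \<notin> E" for d u v
    unfolding S_def using that by (intro cSUP_least third diff_le) auto
  have le_S: "\<bar>w {u, x} - w {v, x}\<bar> \<le> S u v"
    if V: "u \<in> V" "v \<in> V" "u \<noteq> v" "{u, v} \<notin> E" "x \<in> V - {u, v}" for u v x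
    unfolding S_def using that diff_le[OF \<rho> V(1-4)]
    by (intro cSUP_upper bdd_aboveI2[where M = "\<rho> u v"]) auto
  have S_nonneg: "0 \<le> S u v" if "u \<in> V" "v \<in> V" "u \<noteq> v" "{u, v} \<notin> E" for u v
  proof -
    have "V - {u, v} \<noteq> {}" using third that by simp
    then obtain x where "x \<in> V - {u, v}" by blast
    then show ?thesis using le_S[OF that, of x] by linarith
  qed
  have r_mem: "r \<in> metrizations V E w"
  proof (rule metrization_of_nonedge_bounds[OF M \<rho>])
    fix u v assume V: "u \<in> V" "v \<in> V"
    show "0 \<le> r u v" using V w_nonneg S_nonneg by (simp add: r_def)
    show "r u v = r v u" by (simp add: r_def S_def insert_commute abs_minus_commute)
    show "r u u = 0" by (simp add: r_def)
    show "{u, v} \<in> E \<Longrightarrow> r u v = w {u, v}"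
      using simple_graph_no_loop[OF G] by (auto simp: r_def)
  next
    fix u v x assume V: "u \<in> V" "v \<in> V" "x \<in> V" "u \<noteq> v" "x \<noteq> u" "x \<noteq> v" "{u, v} \<notin> E"
    show "\<bar>w {u, x} - w {v, x}\<bar> \<le> r u v" using le_S[of u v x] V by (simp add: r_def)
    \<comment> \<open>The upper bound passes through \<open>\<rho>\<close>: \<open>S u v\<close> is
      at most \<open>\<rho> u v\<close>, which obeys the triangle inequality via
      \<open>x\<close>.\<close>
    have "{u, x} \<in> E" "{v, x} \<in> E" using complement_matchingD[OF M, of u v x] V by auto
    then have "\<rho> u x = w {u, x}" "\<rho> v x = w {v, x}"
      using \<rho> V by (auto simp: metrizations_def)
    moreover have "\<rho> u v \<le> \<rho> u x + \<rho> x v" "\<rho> x v = \<rho> v x"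
      using \<rho> V by (auto simp: metrizations_def pseudometric_on_def)
    ultimately show "r u v \<le> w {u, x} + w {v, x}"
      using S_le[OF \<rho>, of u v] V by (simp add: r_def)
  qed
  have "r u v \<le> d u v" if "d \<in> metrizations V E w" "u \<in> V" "v \<in> V" for d u v
    using that S_le[of d u v] by (auto simp: r_def metrizations_def pseudometric_on_def)
  then have "least_metrization V E w r" using r_mem by (simp add: least_metrization_def)
  moreover have "f \<in> metrizations V E w"
    if f: "\<And>u v. u \<in> V \<Longrightarrow> v \<in> V \<Longrightarrow> 0 \<le> f u v" "\<And>u v. u \<in> V \<Longrightarrow> v \<in> V \<Longrightarrow> f u v = f v u"
      and lower: "\<And>u v. u \<in> V \<Longrightarrow> v \<in> V \<Longrightarrow> r u v \<le> f u v"
      and upper: "\<And>u v. u \<in> V \<Longrightarrow> v \<in> V \<Longrightarrow> ereal (f u v) \<le> path_dist V E w u v"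
    for f :: "'a \<Rightarrow> 'a \<Rightarrow> real"
  proof (rule metrization_of_nonedge_bounds[OF M \<rho> f])
    \<comment> \<open>Vanishing on the diagonal is not assumed of \<open>f\<close>; the one-vertex
      path forces it.\<close>
    fix u assume "u \<in> V"
    then have "ereal (f u u) \<le> 0"
      by (intro order_trans[OF upper path_dist_self_le])
    then show "f u u = 0" using f(1)[of u u] \<open>u \<in> V\<close> by simp
  next
    fix u v assume V: "u \<in> V" "v \<in> V" "{u, v} \<in> E"
    then have "u \<noteq> v" using simple_graph_no_loop[OF G] by auto
    then have "ereal (f u v) \<le> ereal (w {u, v})"
      using V by (intro order_trans[OF upper path_dist_edge_le])
    then show "f u v = w {u, v}" using lower[of u v] V \<open>u \<noteq> v\<close> by (simp add: r_def)
  next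
    fix u v x assume V: "u \<in> V" "v \<in> V" "x \<in> V" "u \<noteq> v" "x \<noteq> u" "x \<noteq> v" "{u, v} \<notin> E"
    show "\<bar>w {u, x} - w {v, x}\<bar> \<le> f u v"
      using le_S[of u v x] lower[of u v] V by (simp add: r_def)
    have "{u, x} \<in> E" "{x, v} \<in> E"
      using complement_matchingD[OF M, of u v x] V by (auto simp: insert_commute)
    then have "ereal (f u v) \<le> ereal (w {u, x} + w {x, v})"
      using V by (intro order_trans[OF upper path_dist_two_edges_le])
    then show "f u v \<le> w {u, x} + w {v, x}" by (simp add: insert_commute)
  qed auto
  ultimately show ?thesis by blast
qed

section \<open>Necessity, from the constant weight 1\<close>

text \<open>Gluing \<open>a\<close> to \<open>b\<close> in the discrete metric leaves every edge at
  length 1, because \<open>{a, b}\<close> is not an edge. The case \<open>a = b\<close> is allowed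
  and gives the discrete metric itself.\<close>

lemma one_metrization_identifying:
  assumes G: "simple_graph V E" and nE: "{a, b} \<notin> E"
  shows "(\<lambda>u v. if u = v \<or> {u, v} = {a, b} then 0 else 1) \<in> metrizations V E (\<lambda>_. 1)"
  using simple_graph_no_loop[OF G] nE
  unfolding metrizations_def pseudometric_on_def by (auto simp: doubleton_eq_iff insert_commute)

lemma least_metrization_imp_complement_matching:
  assumes G: "simple_graph V E"
    and least: "\<And>w. metrizable_weight V E w \<Longrightarrow>
        \<exists>\<rho>\<^sub>0. least_metrization V E w \<rho>\<^sub>0 \<and>
          (\<forall>f :: 'a \<Rightarrow> 'a \<Rightarrow> real.
             (\<forall>u\<in>V. \<forall>v\<in>V. 0 \<le> f u v \<and> f u v = f v u) \<and>
             (\<forall>u\<in>V. \<forall>v\<in>V. \<rho>\<^sub>0 u v \<le> f u v \<and> ereal (f u v) \<le> path_dist V E w u v)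
             \<longrightarrow> f \<in> metrizations V E w)"
  shows "complement_matching V E"
proof -
  let ?w = "\<lambda>_ :: 'a set. 1 :: real"
  \<comment> \<open>The witness is the discrete metric, obtained by identifying a vertex with
    itself.\<close>
  have "metrizable_weight V E ?w"
    using one_metrization_identifying[OF G simple_graph_no_loop[OF G]]
    unfolding metrizable_weight_def graph_weight_def by auto
  then obtain r where r: "least_metrization V E ?w r"
    and between: "\<And>f :: 'a \<Rightarrow> 'a \<Rightarrow> real. \<lbrakk>\<forall>u\<in>V. \<forall>v\<in>V. 0 \<le> f u v \<and> f u v = f v u;
      \<forall>u\<in>V. \<forall>v\<in>V. r u v \<le> f u v \<and> ereal (f u v) \<le> path_dist V E ?w u v\<rbrakk>
      \<Longrightarrow> f \<in> metrizations V E ?w"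
    using least[of ?w] by blast
  have rm: "r \<in> metrizations V E ?w" using r by (simp add: least_metrization_def)
  have r_nonneg: "0 \<le> r u v" if "u \<in> V" "v \<in> V" for u v
    using rm that by (simp add: metrizations_def pseudometric_on_def)
  have r_nonedge: "r u v = 0" if "u \<in> V" "v \<in> V" "{u, v} \<notin> E" for u v
  proof -
    have "r u v \<le> d u v" if "d \<in> metrizations V E ?w" for d
      using r that \<open>u \<in> V\<close> \<open>v \<in> V\<close> by (simp add: least_metrization_def)
    from this[OF one_metrization_identifying[OF G that(3)]] have "r u v \<le> 0" by simp
    then show ?thesis using r_nonneg[of u v] that by simp
  qed
  have r_edge: "r u v = 1" if "u \<in> V" "v \<in> V" "{u, v} \<in> E" for u v
    using rm that by (simp add: metrizations_def)
  show ?thesis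
    unfolding complement_matching_def
  proof (intro ballI impI, elim conjE, rule ccontr)
    fix b a c assume V: "b \<in> V" "a \<in> V" "c \<in> V" and ne: "b \<noteq> a" "c \<noteq> b" "c \<noteq> a"
      and nE: "{b, a} \<notin> E" "{b, c} \<notin> E"
    \<comment> \<open>Both non-edges at \<open>b\<close> have \<open>r\<close>-length 0, so
      \<open>r a c\<close> is 0 and \<open>a\<close>, \<open>c\<close> cannot be joined by an edge
      of weight 1.\<close>
    have "r a c \<le> r a b + r b c"
      using rm V by (simp add: metrizations_def pseudometric_on_def)
    also have "\<dots> = 0" using r_nonedge V nE by (simp add: insert_commute)
    finally have ac: "{a, c} \<notin> E" using r_edge[of a c] V by auto
    \<comment> \<open>This is \<open>r\<close> raised at the single pair \<open>{a, b}\<close>; the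
      triangle inequality then fails via \<open>c\<close>, where both legs are non-edges of value
      0.\<close>
    define f :: "'a \<Rightarrow> 'a \<Rightarrow> real"
      where "f u v = (if {u, v} \<in> E \<or> {u, v} = {a, b} then 1 else 0)" for u v
    have "f \<in> metrizations V E ?w"
    proof (rule between; intro ballI)
      fix u v assume uv: "u \<in> V" "v \<in> V"
      show "0 \<le> f u v \<and> f u v = f v u" by (simp add: f_def insert_commute)
      have "r u v \<le> f u v" using r_edge[OF uv] r_nonedge[OF uv] by (cases "{u, v} \<in> E") (auto simp: f_def)
      moreover have "ereal (f u v) \<le> path_dist V E ?w u v"
      proof (cases "u = v")
        case True
        then have "f u v = 0"
          using simple_graph_no_loop[OF G, of v] ne by (auto simp: f_def doubleton_eq_iff)
        moreover have "0 \<le> path_dist V E ?w u v"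
          unfolding path_dist_def by (rule INF_greatest) simp
        ultimately show ?thesis by (simp add: zero_ereal_def)
      next
        case False
        have "ereal (f u v) \<le> 1" by (simp add: f_def one_ereal_def)
        then show ?thesis by (rule order_trans[OF _ path_dist_one_ge[OF False]])
      qed
      ultimately show "r u v \<le> f u v \<and> ereal (f u v) \<le> path_dist V E ?w u v" ..
    qed
    then have "f a b \<le> f a c + f c b"
      using V unfolding metrizations_def pseudometric_on_def by blast
    moreover have "f a b = 1" "f a c = 0" "f c b = 0"
      using ac nE ne by (auto simp: f_def doubleton_eq_iff insert_commute)
    ultimately show False by simp
  qed
qed

theorem theorem4p11:
  fixes V :: "'a set" and E :: "'a set set"
  assumes "simple_graph V E" and "E \<noteq> {}"
  shows
    "(\<forall>w :: 'a set \<Rightarrow> real. metrizable_weight V E w \<longrightarrow>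
        (\<exists>\<rho>\<^sub>0. least_metrization V E w \<rho>\<^sub>0 \<and>
          (\<forall>f :: 'a \<Rightarrow> 'a \<Rightarrow> real.
             (\<forall>u\<in>V. \<forall>v\<in>V. 0 \<le> f u v \<and> f u v = f v u) \<and>
             (\<forall>u\<in>V. \<forall>v\<in>V. \<rho>\<^sub>0 u v \<le> f u v \<and> ereal (f u v) \<le> path_dist V E w u v)
             \<longrightarrow> f \<in> metrizations V E w)))
     \<longleftrightarrow>
     (\<exists>P. complete_partite V E P \<and> (finite P \<longrightarrow> 2 \<le> card P) \<and>
        (\<forall>A\<in>P. finite A \<and> card A \<le> 2))"
    (is "?i \<longleftrightarrow> ?ii")
proof
  assume ?i
  then have "complement_matching V E"
    using least_metrization_imp_complement_matching[OF assms(1)] by blast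
  then show ?ii by (rule complement_matching_imp_complete_partite[OF assms])
next
  assume ?ii
  then have "complement_matching V E" using complete_partite_imp_complement_matching by blast
  then show ?i using complement_matching_imp_least_metrization[OF assms] by blast
qed

end
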